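(* Let $X$ be a finite connected simplicial complex on $n$ vertices and let $k \geq 1$. Then $$k\,\mu_k(X) \geq (k+1)\,\mu_{k-1}(X) - n - \sum_{j=2}^{k+1}\bigl(k(k+1)+j\bigr)\, D_k(X,j),$$ where $\mu_i(X)$ denotes the minimal eigenvalue of the reduced $i$-Laplacian of $X$ and, for $1\le j\le k+1$, $D_k(X,j)$ is the maximum over all $k$-simplices $\sigma$ of $X$ of the number of vertices $u$ of $X$ such that $u\notin \mathrm{lk}_X(\sigma)$ and there are exactly $j$ vertices $v\in\sigma$ with $u\in \mathrm{lk}_X(\sigma\setminus\{v\})$.
   Context: Simplicial complexes are finite abstract simplicial complexes. Each simplex is given an arbitrary fixed orientation and $X(k)$ denotes the set of $k$-dimensional (oriented) simplices of $X$ (one per underlying $k$-simplex). $X$ is connected if its $1$-skeleton (the graph formed by its $0$- and $1$-simplices) is connected. The link of a simplex $\sigma\in X$ is $\mathrm{lk}_X(\sigma)=\{\eta\in X : \sigma\cup\eta\in X,\ \sigma\cap\eta=\emptyset\}$; for a vertex $u$, $u\in \mathrm{lk}_X(\sigma)$ means $\{u\}\in\mathrm{lk}_X(\sigma)$. $C^k(X;\mathbb{R})$ is the space of real-valued $k$-cochains of $X$ for $k\ge 0$ (alternating under change of orientation), with $C^{-1}(X;\mathbb{R})=\mathbb{R}$. The coboundary operator $\delta_k: C^k(X;\mathbb{R})\to C^{k+1}(X;\mathbb{R})$ is $\delta_k\phi([v_0,\dots,v_{k+1}])=\sum_{j=0}^{k+1}(-1)^j\phi([v_0,\dots,\widehat{v_j},\dots,v_{k+1}])$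 for $k\ge 0$, and $\delta_{-1}(x)(v)=x$ for $x\in\mathbb{R}$ and every vertex $v$. Each $C^k(X;\mathbb{R})$ carries the inner product $\langle\phi,\psi\rangle=\sum_{\sigma\in X(k)}\phi(\sigma)\psi(\sigma)$ (for $k=-1$, the usual product on $\mathbb{R}$), and $\delta_k^*$ is the adjoint of $\delta_k$. For $k\ge 0$, the reduced $k$-Laplacian is $\Delta_k(X)=\delta_{k-1}\delta_{k-1}^*+\delta_k^*\delta_k$ on $C^k(X;\mathbb{R})$, and $\mu_k(X)$ is its minimal eigenvalue (defined when $X$ has at least one $k$-simplex, so the inequality is understood for $X(k)\neq\emptyset$). *)

theory Defs
  imports Complex_Main "HOL-Combinatorics.Permutations"
begin

text \<open>
  Abstract simplicial complexes are represented as downward closed families of finite vertex sets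
  which contain the empty simplex, the unique simplex of dimension \<open>-1\<close>. Dimensions are integers,
  so that \<open>C\<^sup>-\<^sup>1\<close> is covered by the same definitions as \<open>C\<^sup>k\<close> for \<open>k \<ge> 0\<close>.
\<close>

definition finite_simplicial_complex :: "'a set set \<Rightarrow> bool" where
  "finite_simplicial_complex X \<longleftrightarrow>
     finite X \<and> {} \<in> X \<and> (\<forall>\<sigma>\<in>X. finite \<sigma> \<and> (\<forall>\<tau>. \<tau> \<subseteq> \<sigma> \<longrightarrow> \<tau> \<in> X))"

definition vertices :: "'a set set \<Rightarrow> 'a set" where
  "vertices X = {v. {v} \<in> X}"

definition simplices :: "'a set set \<Rightarrow> int \<Rightarrow> 'a set set" where
  "simplices X k = {\<sigma> \<in> X. finite \<sigma> \<and> int (card \<sigma>) = k + 1}"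

definition connected_complex :: "'a set set \<Rightarrow> bool" where
  "connected_complex X \<longleftrightarrow>
     (\<forall>u\<in>vertices X. \<forall>v\<in>vertices X. (u, v) \<in> {(a, b). a \<noteq> b \<and> {a, b} \<in> X}\<^sup>*)"

definition link :: "'a set set \<Rightarrow> 'a set \<Rightarrow> 'a set set" where
  "link X \<sigma> = {\<eta> \<in> X. \<sigma> \<union> \<eta> \<in> X \<and> \<sigma> \<inter> \<eta> = {}}"

text \<open>
  An oriented simplex \<open>[v\<^sub>0, \<dots>, v\<^sub>k]\<close> is given by an ordering of its vertices. An orientation of
  the complex picks one ordering of each simplex, representing its orientation.
\<close>

definition ordered_simplices :: "'a set set \<Rightarrow> int \<Rightarrow> 'a list set" where
  "ordered_simplices X k = {vs. distinct vs \<and> set vs \<in> X \<and> int (length vs) = k + 1}"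

definition orientation :: "'a set set \<Rightarrow> ('a set \<Rightarrow> 'a list) \<Rightarrow> bool" where
  "orientation X ornt \<longleftrightarrow> (\<forall>\<sigma>\<in>X. distinct (ornt \<sigma>) \<and> set (ornt \<sigma>) = \<sigma>)"

text \<open>
  Cochains are extended by zero to lists that are not ordered \<open>k\<close>-simplices, so that equality of
  cochains is equality of functions. For \<open>k = -1\<close> the only ordered simplex is the empty list, and
  a cochain amounts to its value there, a real number.
\<close>

definition cochains :: "'a set set \<Rightarrow> int \<Rightarrow> ('a list \<Rightarrow> real) set" where
  "cochains X k = {\<phi>.
     (\<forall>vs. vs \<notin> ordered_simplices X k \<longrightarrow> \<phi> vs = 0) \<and>
     (\<forall>vs\<in>ordered_simplices X k. \<forall>p. p permutes {..<length vs} \<longrightarrow>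
        \<phi> (permute_list p vs) = of_int (sign p) * \<phi> vs)}"

text \<open>For \<open>k = -1\<close> the sum below is the single term \<open>\<phi> []\<close>.\<close>

definition coboundary :: "'a set set \<Rightarrow> int \<Rightarrow> ('a list \<Rightarrow> real) \<Rightarrow> 'a list \<Rightarrow> real" where
  "coboundary X k \<phi> vs =
     (if vs \<in> ordered_simplices X (k + 1)
      then \<Sum>j<length vs. (- 1) ^ j * \<phi> (take j vs @ drop (Suc j) vs)
      else 0)"

definition cochain_inner ::
  "'a set set \<Rightarrow> ('a set \<Rightarrow> 'a list) \<Rightarrow> int \<Rightarrow> ('a list \<Rightarrow> real) \<Rightarrow> ('a list \<Rightarrow> real) \<Rightarrow> real" where
  "cochain_inner X ornt k \<phi> \<psi> = (\<Sum>\<sigma>\<in>simplices X k. \<phi> (ornt \<sigma>) * \<psi> (ornt \<sigma>))"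

text \<open>
  The adjoint \<open>C\<^sup>k\<^sup>+\<^sup>1 \<rightarrow> C\<^sup>k\<close> of the coboundary; the described cochain exists uniquely because
  \<open>C\<^sup>k\<close> is a finite-dimensional inner product space. Meaningful only on \<open>C\<^sup>k\<^sup>+\<^sup>1\<close>.
\<close>

definition coboundary_adjoint ::
  "'a set set \<Rightarrow> ('a set \<Rightarrow> 'a list) \<Rightarrow> int \<Rightarrow> ('a list \<Rightarrow> real) \<Rightarrow> 'a list \<Rightarrow> real" where
  "coboundary_adjoint X ornt k \<psi> =
     (THE \<chi>. \<chi> \<in> cochains X k \<and>
        (\<forall>\<phi>\<in>cochains X k.
           cochain_inner X ornt (k + 1) (coboundary X k \<phi>) \<psi> = cochain_inner X ornt k \<phi> \<chi>))"

definition reduced_laplacian ::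
  "'a set set \<Rightarrow> ('a set \<Rightarrow> 'a list) \<Rightarrow> int \<Rightarrow> ('a list \<Rightarrow> real) \<Rightarrow> 'a list \<Rightarrow> real" where
  "reduced_laplacian X ornt k \<phi> = (\<lambda>vs.
     coboundary X (k - 1) (coboundary_adjoint X ornt (k - 1) \<phi>) vs +
     coboundary_adjoint X ornt k (coboundary X k \<phi>) vs)"

definition laplacian_eigenvalue ::
  "'a set set \<Rightarrow> ('a set \<Rightarrow> 'a list) \<Rightarrow> int \<Rightarrow> real \<Rightarrow> bool" where
  "laplacian_eigenvalue X ornt k c \<longleftrightarrow>
     (\<exists>\<phi>\<in>cochains X k. \<phi> \<noteq> (\<lambda>vs. 0) \<and> reduced_laplacian X ornt k \<phi> = (\<lambda>vs. c * \<phi> vs))"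

definition min_eigenvalue :: "'a set set \<Rightarrow> ('a set \<Rightarrow> 'a list) \<Rightarrow> int \<Rightarrow> real" where
  "min_eigenvalue X ornt k = (LEAST c. laplacian_eigenvalue X ornt k c)"

definition max_link_defect :: "'a set set \<Rightarrow> int \<Rightarrow> nat \<Rightarrow> nat" where
  "max_link_defect X k j =
     Max ((\<lambda>\<sigma>. card {u \<in> vertices X. {u} \<notin> link X \<sigma> \<and>
                        card {v \<in> \<sigma>. {u} \<in> link X (\<sigma> - {v})} = j}) ` simplices X k)"

end

theory Submission
  imports Defs "HOL-Analysis.Function_Topology" "HOL-Analysis.Convex" "HOL-Combinatorics.Multiset_Permutations"
begin


text \<open>
  For a \<open>k\<close>-cochain \<open>\<phi>\<close> and a vertex \<open>u\<close> consider the slice \<open>\<phi>\<^sub>u(\<tau>) = \<phi>(u\<tau>)\<close>, a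
  \<open>(k-1)\<close>-cochain (zero where \<open>u\<tau>\<close> is not a simplex). Take for \<open>\<phi>\<close> an eigenvector of the smallest
  eigenvalue of the \<open>k\<close>-Laplacian, apply the Rayleigh bound of dimension \<open>k-1\<close> to every slice and add
  up over \<open>u\<close>. Norms add up to \<open>(k+1)\<parallel>\<phi>\<parallel>\<^sup>2\<close>, and since \<open>\<delta>\<^sup>*\<phi>\<^sub>u = -(\<delta>\<^sup>*\<phi>)\<^sub>u\<close>, the codifferentials
  add up to \<open>k\<parallel>\<delta>\<^sup>*\<phi>\<parallel>\<^sup>2\<close>. The coboundaries carry the content
  (\<open>sum_tuple_inner_d_slice_le\<close>), and one compares \<open>(\<delta>\<phi>\<^sub>u)(\<tau>)\<close> with \<open>\<phi>(\<tau>)\<close> for each pair of a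
  vertex \<open>u\<close> and a \<open>k\<close>-simplex \<open>\<tau>\<close>:

  \<^item> If \<open>u\<close> lies in the link of \<open>\<tau>\<close>, then \<open>(\<delta>\<phi>\<^sub>u)(\<tau>) = \<phi>(\<tau>) - (\<delta>\<phi>)(u\<tau>)\<close>. After squaring and summing,
    the mixed terms give \<open>-2\<parallel>\<delta>\<phi>\<parallel>\<^sup>2\<close> and the last ones \<open>(k+2)\<parallel>\<delta>\<phi>\<parallel>\<^sup>2\<close>.

  \<^item> Otherwise \<open>(\<delta>\<phi>\<^sub>u)(\<tau>)\<close> is a signed sum of \<open>J\<close> values \<open>\<phi>(u\<tau>\<^sub>v)\<close>, where \<open>J\<close> counts the vertices \<open>v\<close>
    of \<open>\<tau>\<close> with \<open>u\<close> in the link of \<open>\<tau>\<^sub>v = \<tau> - v\<close>. By Cauchy-Schwarz its square is at most \<open>J\<close> times the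
    sum of the squares. Exchanging \<open>u\<close> and \<open>v\<close> turns \<open>(u, \<tau>)\<close> into \<open>(v, u\<tau>\<^sub>v)\<close>. This is an involution
    on such pairs, and it preserves \<open>J\<close> because both members span the same set \<open>\<tau> \<union> {u}\<close> and
    \<open>J + 1\<close> counts its facets in the complex when \<open>u \<notin> \<tau>\<close>. So the total is at most
    the sum of \<open>J\<^sup>2 \<phi>(\<tau>)\<^sup>2\<close> over these pairs.

  For a fixed \<open>\<tau>\<close> each vertex therefore costs at most \<open>1\<close>, except that a vertex outside the link with
  \<open>J \<ge> 2\<close> costs \<open>J\<^sup>2\<close>; as \<open>J \<le> k+1\<close>, one has \<open>J\<^sup>2 \<le> 1 + k(k+1) + J\<close>. This yields the term \<open>n\<close> and the sum
  over \<open>j\<close> in the theorem.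

  Two devices keep the computation short. All inner products are taken over all ordered tuples of
  vertices instead of one orientation per simplex, which only multiplies them by a factorial
  (\<open>tuple_inner_eq_cochain_inner\<close>) and turns sums over pairs \<open>(u, \<tau>)\<close> into sums over longer tuples.
  And the alternating face sum satisfies \<open>\<partial>f(u\<tau>) = f(\<tau>) - \<partial>f\<^sub>u(\<tau>)\<close>, so that its properties follow
  by induction on the tuple. The Rayleigh characterisation of the smallest eigenvalue comes from
  compactness of the unit sphere of cochains (\<open>min_eigenvalue_variational\<close>).
\<close>

section \<open>Alternating functions on tuples\<close>

text \<open>
  Sign changes under adjacent swaps determine the behaviour under all permutations, and unlike the
  latter they can be checked by induction on the prefix \<open>xs\<close>.
\<close>

definition alternating :: "('a list \<Rightarrow> real) \<Rightarrow> bool" where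
  "alternating f \<longleftrightarrow> (\<forall>xs a b ys. f (xs @ a # b # ys) = - f (xs @ b # a # ys))"

lemma alternatingD: "alternating f \<Longrightarrow> f (xs @ a # b # ys) = - f (xs @ b # a # ys)"
  unfolding alternating_def by blast

lemma alternating_Cons_Cons: "alternating f \<Longrightarrow> f (a # b # ys) = - f (b # a # ys)"
  using alternatingD[of f "[]" a b ys] by simp

lemma alternating_slice:
  assumes "alternating f"
  shows "alternating (\<lambda>vs. f (u # vs))"
proof (unfold alternating_def, intro allI)
  show "f (u # xs @ a # b # ys) = - f (u # xs @ b # a # ys)" for xs a b ys
    using alternatingD[OF assms, of "u # xs" a b ys] by simp
qed

lemma alternating_move:
  assumes "alternating f"
  shows "f (xs @ a # ms @ ys) = (- 1) ^ length ms * f (xs @ ms @ a # ys)"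
proof (induction ms arbitrary: xs)
  case (Cons c ms)
  have "f (xs @ a # (c # ms) @ ys) = - f ((xs @ [c]) @ a # ms @ ys)"
    using alternatingD[OF assms, of xs a c "ms @ ys"] by simp
  also have "\<dots> = - ((- 1) ^ length ms * f ((xs @ [c]) @ ms @ a # ys))"
    by (simp only: Cons.IH)
  finally show ?case by simp
qed simp

lemma alternating_swap:
  assumes "alternating f"
  shows "f (xs @ a # ms @ b # ys) = - f (xs @ b # ms @ a # ys)"
  using alternating_move[OF assms, of xs a ms "b # ys"] alternating_move[OF assms, of xs b ms "a # ys"]
    alternatingD[OF assms, of "xs @ ms" a b ys] by simp

lemma permute_list_transpose:
  "permute_list (Transposition.transpose (length xs) (length xs + Suc (length ms))) (xs @ a # ms @ b # ys)
     = xs @ b # ms @ a # ys"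
  (is "permute_list ?p ?vs = ?ws")
proof (rule nth_equalityI)
  have p: "?p permutes {..<length ?vs}"
    by (rule permutes_swap_id) auto
  fix i assume "i < length (permute_list ?p ?vs)"
  then have "permute_list ?p ?vs ! i = ?vs ! ?p i"
    by (intro permute_list_nth p) simp
  then show "permute_list ?p ?vs ! i = ?ws ! i"
    by (auto simp: Transposition.transpose_def nth_append nth_Cons split: nat.split if_splits)
qed simp

lemma alternating_permute_list:
  assumes alt: "alternating f" and p: "p permutes {..<length vs}"
  shows "f (permute_list p vs) = of_int (sign p) * f vs"
  using finite_lessThan p
proof (induction rule: permutes_rev_induct)
  case (swap i j p)
  have transp: "f (permute_list (Transposition.transpose i j) ws) = - f ws"
    if "i < j" "j < length ws" for i j and ws :: "'a list"
  proof -
    define ms where "ms = drop (Suc i) (take j ws)"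
    have "ws = take i ws @ ws ! i # ms @ ws ! j # drop (Suc j) ws" (is "_ = ?xs @ ?a # ms @ ?b # ?ys")
    proof -
      have "take j ws = take i (take j ws) @ take j ws ! i # drop (Suc i) (take j ws)"
        by (rule id_take_nth_drop) (use that in simp)
      moreover have "ws = take j ws @ ws ! j # drop (Suc j) ws"
        by (rule id_take_nth_drop) (use that in simp)
      ultimately show ?thesis
        using that by (metis append.assoc append_Cons less_imp_le_nat min_absorb1 ms_def nth_take take_take)
    qed
    moreover have "length ?xs = i" "length ?xs + Suc (length ms) = j"
      using that by (auto simp: ms_def)
    ultimately show ?thesis
      using permute_list_transpose[of ?xs ms ?a ?b ?ys] alternating_swap[OF alt, of ?xs ?b ms ?a ?ys]
      by metis
  qed
  have "f (permute_list (p \<circ> Transposition.transpose i j) vs)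
      = f (permute_list (Transposition.transpose i j) (permute_list p vs))"
    using swap by (subst permute_list_compose) (auto intro: permutes_swap_id)
  also have "\<dots> = - f (permute_list p vs)"
    using swap transp[of i j "permute_list p vs"] transp[of j i "permute_list p vs"]
    by (cases "i < j") (auto simp: transpose_commute)
  also have "\<dots> = of_int (sign (p \<circ> Transposition.transpose i j)) * f vs"
    using swap.hyps swap.IH permutes_imp_permutation[OF finite_lessThan swap.hyps(4)]
    by (simp add: sign_compose permutation_swap_id sign_swap_id)
  finally show ?case .
qed simp

text \<open>
  The sign depends only on the two orderings; hence products of two alternating functions do not
  depend on the orientation of a simplex.
\<close>

lemma alternating_same_set:
  assumes "distinct xs" "distinct ys" "set xs = set ys"
  shows "\<exists>s\<in>{1, -1}. \<forall>g. alternating g \<longrightarrow> g ys = s * g xs"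
proof -
  have "mset xs = mset ys"
    using assms by (simp add: set_eq_iff_mset_eq_distinct)
  then obtain p where p: "p permutes {..<length xs}" "permute_list p xs = ys"
    by (metis mset_eq_permutation)
  with alternating_permute_list[OF _ p(1)] show ?thesis
    by (intro bexI[of _ "of_int (sign p)"]) (auto simp: sign_def)
qed

section \<open>The alternating face sum\<close>

definition alt_sum :: "('a list \<Rightarrow> real) \<Rightarrow> 'a list \<Rightarrow> real" where
  "alt_sum f vs = (\<Sum>j<length vs. (- 1) ^ j * f (take j vs @ drop (Suc j) vs))"

lemma alt_sum_Nil [simp]: "alt_sum f [] = 0"
  by (simp add: alt_sum_def)

lemma alt_sum_Cons [simp]: "alt_sum f (u # vs) = f vs - alt_sum (\<lambda>ws. f (u # ws)) vs"
  by (simp add: alt_sum_def sum.lessThan_Suc_shift sum_negf del: sum.lessThan_Suc)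

text \<open>
  In the base case the two leading summands of \<open>alt_sum_Cons\<close>, applied twice, trade places.
\<close>

lemma alternating_alt_sum:
  assumes "alternating f"
  shows "alternating (alt_sum f)"
proof -
  have "alt_sum f (xs @ a # b # ys) = - alt_sum f (xs @ b # a # ys)" for xs a b ys
    using assms
  proof (induction xs arbitrary: f)
    case Nil
    have "alt_sum (\<lambda>ws. f (a # b # ws)) ys = - alt_sum (\<lambda>ws. f (b # a # ws)) ys"
      by (subst alternating_Cons_Cons[OF Nil]) (simp add: alt_sum_def sum_negf)
    then show ?case by simp
  next
    case (Cons x xs)
    then show ?case
      using alternatingD[OF Cons.prems, of xs a b ys] Cons.IH[OF alternating_slice[OF Cons.prems]]
      by simp
  qed
  then show ?thesis unfolding alternating_def by blast
qed

definition tuples :: "'a set \<Rightarrow> nat \<Rightarrow> 'a list set" where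
  "tuples V m = {vs. set vs \<subseteq> V \<and> length vs = m}"

lemma finite_tuples: "finite V \<Longrightarrow> finite (tuples V m)"
  unfolding tuples_def by (rule finite_lists_length_eq)

lemma tuples_0 [simp]: "tuples V 0 = {[]}"
  by (auto simp: tuples_def)

lemma sum_tuples_Suc:
  "sum f (tuples V (Suc m)) = (\<Sum>u\<in>V. \<Sum>vs\<in>tuples V m. f (u # vs))"
proof -
  have "sum f (tuples V (Suc m)) = (\<Sum>(u, vs)\<in>V \<times> tuples V m. f (u # vs))"
    by (rule sum.reindex_bij_witness[of _ "\<lambda>(u, vs). u # vs" "\<lambda>vs. (hd vs, tl vs)"])
      (auto simp: tuples_def length_Suc_conv)
  then show ?thesis by (simp add: sum.cartesian_product)
qed

text \<open>
  Adjointness of the face sum and the cone sum \<open>vs \<mapsto> \<Sum>u. g (u # vs)\<close>. By the recursion for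
  \<open>alt_sum\<close>, the summand \<open>f vs\<close> contributes the right-hand sum once. The recursive summand contributes it
  another \<open>m\<close> times, because exchanging the first two entries of \<open>g\<close> cancels the minus sign.
\<close>

lemma sum_alt_sum_mult:
  assumes "alternating g"
  shows "(\<Sum>ws\<in>tuples V (Suc m). alt_sum f ws * g ws)
       = real (Suc m) * (\<Sum>vs\<in>tuples V m. f vs * (\<Sum>u\<in>V. g (u # vs)))"
  using assms
proof (induction m arbitrary: f g)
  case 0
  show ?case by (simp add: sum_tuples_Suc sum_distrib_left)
next
  case (Suc m)
  let ?D = "\<lambda>u vs. alt_sum (\<lambda>ws. f (u # ws)) vs"
  let ?S = "\<Sum>vs\<in>tuples V (Suc m). f vs * (\<Sum>u\<in>V. g (u # vs))"
  have "(\<Sum>ws\<in>tuples V (Suc (Suc m)). alt_sum f ws * g ws)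
      = (\<Sum>u\<in>V. \<Sum>vs\<in>tuples V (Suc m). f vs * g (u # vs))
      - (\<Sum>u\<in>V. \<Sum>vs\<in>tuples V (Suc m). ?D u vs * g (u # vs))"
    by (simp add: sum_tuples_Suc[of _ V "Suc m"] left_diff_distrib sum_subtractf)
  also have "(\<Sum>u\<in>V. \<Sum>vs\<in>tuples V (Suc m). f vs * g (u # vs)) = ?S"
    by (subst sum.swap) (simp add: sum_distrib_left)
  also have "(\<Sum>u\<in>V. \<Sum>vs\<in>tuples V (Suc m). ?D u vs * g (u # vs))
      = (\<Sum>u\<in>V. real (Suc m) * (\<Sum>vs\<in>tuples V m. f (u # vs) * (\<Sum>v\<in>V. g (u # v # vs))))"
    by (intro sum.cong refl Suc.IH alternating_slice Suc.prems)
  also have "\<dots> = - (real (Suc m) * ?S)"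
    by (subst alternating_Cons_Cons[OF Suc.prems])
      (simp add: sum_tuples_Suc[of _ V m] sum_distrib_left sum_negf)
  finally show ?case by (simp add: algebra_simps)
qed


section \<open>Cochains of an oriented complex\<close>

text \<open>
  The Vandermonde product, an alternating function used to exhibit nonzero cochains.
\<close>

primrec vandermonde :: "('a \<Rightarrow> real) \<Rightarrow> 'a list \<Rightarrow> real" where
  "vandermonde r [] = 1"
| "vandermonde r (a # xs) = (\<Prod>x\<leftarrow>xs. r x - r a) * vandermonde r xs"

lemma alternating_vandermonde: "alternating (vandermonde r)"
proof (unfold alternating_def, intro allI)
  show "vandermonde r (xs @ a # b # ys) = - vandermonde r (xs @ b # a # ys)" for xs a b ys
    by (induction xs) (auto simp: algebra_simps)
qed

lemma vandermonde_nonzero: "inj_on r (set xs) \<Longrightarrow> distinct xs \<Longrightarrow> vandermonde r xs \<noteq> 0"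
  by (induction xs) (auto simp: prod_list_zero_iff inj_on_def)

text \<open>
  The first-order condition at a minimum, here at \<open>t = 0\<close>, in the form needed for quadratic forms.
\<close>

lemma linear_term_zero_of_nonneg:
  fixes c d :: real
  assumes "\<And>t. 0 \<le> 2 * t * c + t\<^sup>2 * d"
  shows "c = 0"
proof (rule ccontr)
  assume "c \<noteq> 0"
  \<comment> \<open>The value \<open>t = - c / (\<bar>d\<bar> + 1)\<close> is close enough to \<open>0\<close> for the linear term to prevail.\<close>
  define e where "e = \<bar>d\<bar> + 1"
  have e: "e > 0" "d - 2 * e < 0"
    by (auto simp: e_def)
  have "2 * (- c / e) * c + (- c / e)\<^sup>2 * d = (c / e)\<^sup>2 * (d - 2 * e)"
    using e by (simp add: field_simps power2_eq_square)
  moreover have "(c / e)\<^sup>2 * (d - 2 * e) < 0"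
    using \<open>c \<noteq> 0\<close> e by (intro mult_pos_neg) auto
  ultimately show False
    using assms[of "- c / e"] by simp
qed

locale oriented_complex =
  fixes X :: "'a set set" and ornt :: "'a set \<Rightarrow> 'a list"
  assumes complex: "finite_simplicial_complex X"
    and ornt: "orientation X ornt"
begin

abbreviation "V \<equiv> vertices X"

text \<open>
  Cochains are indexed by the number \<open>m\<close> of vertices of a simplex, so that slicing and coning act
  on \<open>m\<close> by predecessor and successor.
\<close>

abbreviation "C m \<equiv> cochains X (int m - 1)"

definition face :: "'a list \<Rightarrow> bool" where
  "face vs \<longleftrightarrow> distinct vs \<and> set vs \<in> X"

lemma finite_X: "finite X" and down_closed: "\<sigma> \<in> X \<Longrightarrow> \<tau> \<subseteq> \<sigma> \<Longrightarrow> \<tau> \<in> X"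
  and finite_simplex: "\<sigma> \<in> X \<Longrightarrow> finite \<sigma>"
  using complex by (auto simp: finite_simplicial_complex_def)

lemma simplex_subset_vertices: "\<sigma> \<in> X \<Longrightarrow> \<sigma> \<subseteq> V"
  by (auto simp: vertices_def intro: down_closed)

lemma finite_vertices: "finite V"
proof (rule finite_subset)
  show "V \<subseteq> \<Union> X" by (auto simp: vertices_def)
  show "finite (\<Union> X)" using finite_X finite_simplex by auto
qed

lemma face_tuple: "face vs \<Longrightarrow> vs \<in> tuples V (length vs)"
  using simplex_subset_vertices by (auto simp: face_def tuples_def)

lemma face_swap: "face (xs @ a # b # ys) \<longleftrightarrow> face (xs @ b # a # ys)"
  by (auto simp: face_def insert_commute)

lemma face_ConsD: "face (u # vs) \<Longrightarrow> face vs"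
  by (auto simp: face_def intro: down_closed)

text \<open>
  The support condition makes alternation hold for all tuples: a swap maps faces to faces.
\<close>

lemma cochains_iff:
  "\<phi> \<in> C m \<longleftrightarrow> alternating \<phi> \<and> (\<forall>vs. \<phi> vs \<noteq> 0 \<longrightarrow> face vs \<and> length vs = m)"
proof -
  have ord: "vs \<in> ordered_simplices X (int m - 1) \<longleftrightarrow> face vs \<and> length vs = m" for vs
    by (auto simp: ordered_simplices_def face_def)
  have "alternating \<phi>" if "\<phi> \<in> C m"
  proof (unfold alternating_def, intro allI)
    fix xs ys :: "'a list" and a b
    show "\<phi> (xs @ a # b # ys) = - \<phi> (xs @ b # a # ys)"
    proof (cases "face (xs @ a # b # ys) \<and> length (xs @ a # b # ys) = m")
      case True
      let ?p = "Transposition.transpose (length xs) (Suc (length xs))"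
      have p: "?p permutes {..<length (xs @ a # b # ys)}"
        by (rule permutes_swap_id) auto
      then have "\<phi> (permute_list ?p (xs @ a # b # ys)) = of_int (sign ?p) * \<phi> (xs @ a # b # ys)"
        using that True by (auto simp: cochains_def ord)
      then show ?thesis
        using permute_list_transpose[of xs "[]" a b ys] by (simp add: sign_swap_id)
    next
      case False
      then have "\<phi> (xs @ a # b # ys) = 0" "\<phi> (xs @ b # a # ys) = 0"
        using that face_swap[of xs a b ys] by (auto simp: cochains_def ord)
      then show ?thesis by simp
    qed
  qed
  then show ?thesis
    using alternating_permute_list[of \<phi>] by (auto simp: cochains_def ord)
qed

lemma cochain_alternating: "\<phi> \<in> C m \<Longrightarrow> alternating \<phi>"
  by (simp add: cochains_iff)

lemma cochain_support: "\<phi> \<in> C m \<Longrightarrow> \<phi> vs \<noteq> 0 \<Longrightarrow> face vs \<and> length vs = m"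
  by (simp add: cochains_iff)

lemma cochain_slice: "\<phi> \<in> C (Suc m) \<Longrightarrow> (\<lambda>vs. \<phi> (u # vs)) \<in> C m"
  unfolding cochains_iff using alternating_slice face_ConsD by fastforce

lemma cochain_lincomb:
  assumes "\<phi> \<in> C m" "\<psi> \<in> C m"
  shows "(\<lambda>vs. a * \<phi> vs + b * \<psi> vs) \<in> C m"
  unfolding cochains_iff
proof
  show "alternating (\<lambda>vs. a * \<phi> vs + b * \<psi> vs)"
    unfolding alternating_def
  proof (intro allI)
    show "a * \<phi> (xs @ x # y # ys) + b * \<psi> (xs @ x # y # ys)
        = - (a * \<phi> (xs @ y # x # ys) + b * \<psi> (xs @ y # x # ys))" for xs x y ys
      using alternatingD[OF cochain_alternating[OF assms(1)], of xs x y ys]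
        alternatingD[OF cochain_alternating[OF assms(2)], of xs x y ys] by simp
  qed
  show "\<forall>vs. a * \<phi> vs + b * \<psi> vs \<noteq> 0 \<longrightarrow> face vs \<and> length vs = m"
    using cochain_support[OF assms(1)] cochain_support[OF assms(2)]
    by (metis add.right_neutral mult_zero_right)
qed

definition d :: "nat \<Rightarrow> ('a list \<Rightarrow> real) \<Rightarrow> 'a list \<Rightarrow> real" where
  "d m = coboundary X (int m - 1)"

text \<open>
  On a cochain this is the adjoint of the coboundary (\<open>coboundary_adjoint_eq\<close>). Since cochains vanish
  on tuples that are not faces, the sum over all vertices needs no side condition.
\<close>

definition codiff :: "('a list \<Rightarrow> real) \<Rightarrow> 'a list \<Rightarrow> real" where
  "codiff \<psi> vs = (\<Sum>u\<in>V. \<psi> (u # vs))"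

definition tuple_inner :: "nat \<Rightarrow> ('a list \<Rightarrow> real) \<Rightarrow> ('a list \<Rightarrow> real) \<Rightarrow> real" where
  "tuple_inner m \<phi> \<psi> = (\<Sum>vs\<in>tuples V m. \<phi> vs * \<psi> vs)"

lemma d_eq: "d m \<phi> vs = (if face vs \<and> length vs = Suc m then alt_sum \<phi> vs else 0)"
  by (auto simp: d_def coboundary_def alt_sum_def ordered_simplices_def face_def)

lemma d_cochain:
  assumes "\<phi> \<in> C m"
  shows "d m \<phi> \<in> C (Suc m)"
  unfolding cochains_iff
proof
  show "alternating (d m \<phi>)"
  proof (unfold alternating_def, intro allI)
    show "d m \<phi> (xs @ a # b # ys) = - d m \<phi> (xs @ b # a # ys)" for xs a b ys
      using alternatingD[OF alternating_alt_sum[OF cochain_alternating[OF assms]], of xs a b ys]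
        face_swap[of xs a b ys] by (simp add: d_eq)
  qed
qed (auto simp: d_eq)

lemma codiff_cochain:
  assumes "\<psi> \<in> C (Suc m)"
  shows "codiff \<psi> \<in> C m"
  unfolding cochains_iff
proof
  show "alternating (codiff \<psi>)"
  proof (unfold alternating_def, intro allI)
    show "codiff \<psi> (xs @ a # b # ys) = - codiff \<psi> (xs @ b # a # ys)" for xs a b ys
      unfolding codiff_def sum_negf[symmetric]
      by (intro sum.cong refl alternatingD alternating_slice cochain_alternating[OF assms])
  qed
  show "\<forall>vs. codiff \<psi> vs \<noteq> 0 \<longrightarrow> face vs \<and> length vs = m"
  proof (intro allI impI)
    fix vs assume "codiff \<psi> vs \<noteq> 0"
    then obtain u where "\<psi> (u # vs) \<noteq> 0"
      unfolding codiff_def by (meson sum.not_neutral_contains_not_neutral)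
    then show "face vs \<and> length vs = m"
      using cochain_support[OF assms] face_ConsD by fastforce
  qed
qed

lemma tuple_inner_commute: "tuple_inner m \<phi> \<psi> = tuple_inner m \<psi> \<phi>"
  by (simp add: tuple_inner_def mult.commute)

lemma tuple_inner_self: "tuple_inner m \<phi> \<phi> = (\<Sum>vs\<in>tuples V m. (\<phi> vs)\<^sup>2)"
  by (simp add: tuple_inner_def power2_eq_square)

lemma tuple_inner_nonneg: "0 \<le> tuple_inner m \<phi> \<phi>"
  by (simp add: tuple_inner_self sum_nonneg)

lemma cochain_square_le_tuple_inner: "\<phi> \<in> C m \<Longrightarrow> (\<phi> vs)\<^sup>2 \<le> tuple_inner m \<phi> \<phi>"
  using cochain_support[of \<phi> m vs] face_tuple[of vs]
    member_le_sum[of vs "tuples V m" "\<lambda>vs. (\<phi> vs)\<^sup>2"] tuple_inner_nonneg[of m \<phi>]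
  by (cases "\<phi> vs = 0") (auto simp: tuple_inner_self finite_tuples finite_vertices)

lemma tuple_inner_definite: "\<phi> \<in> C m \<Longrightarrow> tuple_inner m \<phi> \<phi> = 0 \<Longrightarrow> \<phi> = (\<lambda>vs. 0)"
  using cochain_square_le_tuple_inner by fastforce

lemma tuple_inner_combine_left:
  "tuple_inner m (\<lambda>vs. a * \<phi> vs + b * \<psi> vs) \<chi> = a * tuple_inner m \<phi> \<chi> + b * tuple_inner m \<psi> \<chi>"
  by (simp add: tuple_inner_def sum_distrib_left algebra_simps sum.distrib)

lemma tuple_inner_combine_right:
  "tuple_inner m \<chi> (\<lambda>vs. a * \<phi> vs + b * \<psi> vs) = a * tuple_inner m \<chi> \<phi> + b * tuple_inner m \<chi> \<psi>"
  by (simp add: tuple_inner_def sum_distrib_left algebra_simps sum.distrib)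

lemma tuple_inner_d_left:
  assumes "\<psi> \<in> C (Suc m)"
  shows "tuple_inner (Suc m) (d m \<phi>) \<psi> = real (Suc m) * tuple_inner m \<phi> (codiff \<psi>)"
proof -
  have "tuple_inner (Suc m) (d m \<phi>) \<psi> = (\<Sum>ws\<in>tuples V (Suc m). alt_sum \<phi> ws * \<psi> ws)"
    unfolding tuple_inner_def using cochain_support[OF assms] by (intro sum.cong) (auto simp: d_eq)
  then show ?thesis
    by (simp only: sum_alt_sum_mult[OF cochain_alternating[OF assms]] tuple_inner_def codiff_def)
qed

text \<open>
  Each simplex has \<open>m!\<close> orderings, and they all contribute the same product.
\<close>

lemma tuple_inner_eq_cochain_inner:
  assumes "\<phi> \<in> C m" "\<psi> \<in> C m"
  shows "tuple_inner m \<phi> \<psi> = fact m * cochain_inner X ornt (int m - 1) \<phi> \<psi>"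
proof -
  let ?S = "simplices X (int m - 1)"
  have card: "card \<sigma> = m" "\<sigma> \<in> X" "finite \<sigma>" if "\<sigma> \<in> ?S" for \<sigma>
    using that by (auto simp: simplices_def)
  have "tuple_inner m \<phi> \<psi> = (\<Sum>vs\<in>(\<Union>\<sigma>\<in>?S. permutations_of_set \<sigma>). \<phi> vs * \<psi> vs)"
    unfolding tuple_inner_def
  proof (rule sum.mono_neutral_right)
    show "(\<Union>\<sigma>\<in>?S. permutations_of_set \<sigma>) \<subseteq> tuples V m"
      using simplex_subset_vertices
      by (auto simp: simplices_def permutations_of_set_def tuples_def distinct_card)
    show "\<forall>vs\<in>tuples V m - (\<Union>\<sigma>\<in>?S. permutations_of_set \<sigma>). \<phi> vs * \<psi> vs = 0"
    proof
      fix vs assume *: "vs \<in> tuples V m - (\<Union>\<sigma>\<in>?S. permutations_of_set \<sigma>)"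
      have "\<phi> vs = 0"
      proof (rule ccontr)
        assume "\<phi> vs \<noteq> 0"
        with cochain_support[OF assms(1)] have "face vs" "length vs = m" by auto
        then have "set vs \<in> ?S" "vs \<in> permutations_of_set (set vs)"
          by (auto simp: simplices_def permutations_of_set_def face_def distinct_card)
        with * show False by blast
      qed
      then show "\<phi> vs * \<psi> vs = 0" by simp
    qed
  qed (simp add: finite_tuples finite_vertices)
  also have "\<dots> = (\<Sum>\<sigma>\<in>?S. \<Sum>vs\<in>permutations_of_set \<sigma>. \<phi> vs * \<psi> vs)"
  proof (rule sum.UNION_disjoint)
    show "finite ?S"
      using finite_X by (simp add: simplices_def)
    show "\<forall>\<sigma>\<in>?S. finite (permutations_of_set \<sigma>)"
      by simp
  qed (auto simp: permutations_of_set_def)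
  also have "\<dots> = (\<Sum>\<sigma>\<in>?S. fact m * (\<phi> (ornt \<sigma>) * \<psi> (ornt \<sigma>)))"
  proof (intro sum.cong refl)
    fix \<sigma> assume \<sigma>: "\<sigma> \<in> ?S"
    then have o: "distinct (ornt \<sigma>)" "set (ornt \<sigma>) = \<sigma>"
      using ornt card by (auto simp: orientation_def)
    have "\<phi> vs * \<psi> vs = \<phi> (ornt \<sigma>) * \<psi> (ornt \<sigma>)" if "vs \<in> permutations_of_set \<sigma>" for vs
    proof -
      have vs: "distinct vs" "set vs = set (ornt \<sigma>)"
        using that o by (auto simp: permutations_of_set_def)
      obtain s where s: "s \<in> {1, -1}" and "\<forall>g. alternating g \<longrightarrow> g vs = s * g (ornt \<sigma>)"
        using alternating_same_set[OF o(1) vs(1) vs(2)[symmetric]] by blast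
      then have "\<phi> vs = s * \<phi> (ornt \<sigma>)" "\<psi> vs = s * \<psi> (ornt \<sigma>)"
        using assms[THEN cochain_alternating] by auto
      with s show ?thesis by auto
    qed
    then show "(\<Sum>vs\<in>permutations_of_set \<sigma>. \<phi> vs * \<psi> vs) = fact m * (\<phi> (ornt \<sigma>) * \<psi> (ornt \<sigma>))"
      using card[OF \<sigma>] by simp
  qed
  finally show ?thesis
    by (simp add: cochain_inner_def sum_distrib_left)
qed

lemma coboundary_adjoint_eq:
  assumes "\<psi> \<in> C (Suc m)"
  shows "coboundary_adjoint X ornt (int m - 1) \<psi> = codiff \<psi>"
  unfolding coboundary_adjoint_def
proof (rule the_equality)
  have adj: "cochain_inner X ornt (int m - 1 + 1) (coboundary X (int m - 1) \<phi>) \<psi>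
      = cochain_inner X ornt (int m - 1) \<phi> (codiff \<psi>)" if "\<phi> \<in> C m" for \<phi>
  proof -
    have "fact (Suc m) * cochain_inner X ornt (int m) (d m \<phi>) \<psi>
        = real (Suc m) * (fact m * cochain_inner X ornt (int m - 1) \<phi> (codiff \<psi>))"
      using tuple_inner_eq_cochain_inner[OF d_cochain[OF that] assms] tuple_inner_d_left[OF assms, of \<phi>]
        tuple_inner_eq_cochain_inner[OF that codiff_cochain[OF assms]] by simp
    then have "fact (Suc m) * cochain_inner X ornt (int m) (d m \<phi>) \<psi>
        = fact (Suc m) * cochain_inner X ornt (int m - 1) \<phi> (codiff \<psi>)"
      by (simp only: fact_Suc of_nat_mult mult.assoc)
    then show ?thesis
      by (simp add: d_def del: fact_Suc)
  qed
  then show "codiff \<psi> \<in> C m \<and> (\<forall>\<phi>\<in>C m. cochain_inner X ornt (int m - 1 + 1)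
      (coboundary X (int m - 1) \<phi>) \<psi> = cochain_inner X ornt (int m - 1) \<phi> (codiff \<psi>))"
    using codiff_cochain[OF assms] by blast
  fix \<chi> assume \<chi>: "\<chi> \<in> C m \<and> (\<forall>\<phi>\<in>C m. cochain_inner X ornt (int m - 1 + 1)
      (coboundary X (int m - 1) \<phi>) \<psi> = cochain_inner X ornt (int m - 1) \<phi> \<chi>)"
  let ?D = "\<lambda>vs. 1 * \<chi> vs + (- 1) * codiff \<psi> vs"
  have D: "?D \<in> C m"
    using \<chi> codiff_cochain[OF assms] by (blast intro: cochain_lincomb)
  have "cochain_inner X ornt (int m - 1) ?D \<chi> = cochain_inner X ornt (int m - 1) ?D (codiff \<psi>)"
    using \<chi> adj D by metis
  then have "tuple_inner m ?D \<chi> = tuple_inner m ?D (codiff \<psi>)"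
    using tuple_inner_eq_cochain_inner[OF D] \<chi> codiff_cochain[OF assms] by simp
  then have "tuple_inner m ?D ?D = 0"
    by (simp only: tuple_inner_combine_right)
  from tuple_inner_definite[OF D this] show "\<chi> = codiff \<psi>"
    by (auto simp: fun_eq_iff)
qed

section \<open>The smallest eigenvalue as a minimum of the energy\<close>

text \<open>
  The quadratic form of the Laplacian (\<open>tuple_inner_laplacian\<close>). The factors \<open>1 / (m + 1)\<close> and \<open>m\<close> make up
  for the different numbers of orderings of simplices with \<open>m - 1\<close>, \<open>m\<close> and \<open>m + 1\<close> vertices.
\<close>

definition energy :: "nat \<Rightarrow> ('a list \<Rightarrow> real) \<Rightarrow> ('a list \<Rightarrow> real) \<Rightarrow> real" where
  "energy m \<phi> \<psi> = tuple_inner (Suc m) (d m \<phi>) (d m \<psi>) / real (Suc m)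
     + real m * tuple_inner (m - 1) (codiff \<phi>) (codiff \<psi>)"

lemma laplacian_eq:
  assumes "\<phi> \<in> C (Suc p)"
  shows "reduced_laplacian X ornt (int p) \<phi>
       = (\<lambda>vs. 1 * d p (codiff \<phi>) vs + 1 * codiff (d (Suc p) \<phi>) vs)"
  using coboundary_adjoint_eq[OF assms] coboundary_adjoint_eq[OF d_cochain[OF assms]]
  by (simp add: reduced_laplacian_def d_def)

lemma laplacian_cochain:
  assumes "\<phi> \<in> C (Suc p)"
  shows "reduced_laplacian X ornt (int p) \<phi> \<in> C (Suc p)"
  unfolding laplacian_eq[OF assms]
  by (intro cochain_lincomb d_cochain codiff_cochain assms)

lemma tuple_inner_laplacian:
  assumes "\<phi> \<in> C (Suc p)" "\<psi> \<in> C (Suc p)"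
  shows "tuple_inner (Suc p) (reduced_laplacian X ornt (int p) \<phi>) \<psi> = energy (Suc p) \<phi> \<psi>"
proof -
  have "tuple_inner (Suc p) (codiff (d (Suc p) \<phi>)) \<psi>
      = tuple_inner (Suc (Suc p)) (d (Suc p) \<phi>) (d (Suc p) \<psi>) / real (Suc (Suc p))"
    using tuple_inner_d_left[OF d_cochain[OF assms(1)], of \<psi>]
    by (simp add: tuple_inner_commute[of _ "d (Suc p) \<phi>"] tuple_inner_commute[of _ "codiff (d (Suc p) \<phi>)"] del: of_nat_Suc)
  then show ?thesis
    unfolding laplacian_eq[OF assms(1)] tuple_inner_combine_left
    by (simp only: energy_def tuple_inner_d_left[OF assms(2)] diff_Suc_1 mult_1 add.commute)
qed


text \<open>
  A Vandermonde product supported on the orderings of a single simplex.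
\<close>

lemma exists_nonzero_cochain:
  assumes "simplices X (int m - 1) \<noteq> {}"
  shows "\<exists>\<phi>\<in>C m. \<phi> \<noteq> (\<lambda>vs. 0)"
proof -
  obtain \<sigma> where \<sigma>: "\<sigma> \<in> X" "finite \<sigma>" "card \<sigma> = m"
    using assms by (auto simp: simplices_def)
  obtain r :: "'a \<Rightarrow> nat" where r: "inj_on r \<sigma>"
    using finite_imp_inj_to_nat_seg[OF \<sigma>(2)] by blast
  obtain vs where vs: "set vs = \<sigma>" "distinct vs"
    using \<sigma>(2) finite_distinct_list by blast
  let ?w = "vandermonde (\<lambda>v. real (r v))"
  let ?f = "\<lambda>vs. if distinct vs \<and> set vs = \<sigma> then ?w vs else 0"
  have "alternating ?f"
  proof (unfold alternating_def, intro allI)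
    show "?f (xs @ a # b # ys) = - ?f (xs @ b # a # ys)" for xs a b ys
      using alternatingD[OF alternating_vandermonde, of "\<lambda>v. real (r v)" xs a b ys]
      by (auto simp: insert_commute)
  qed
  then have "?f \<in> C m"
    using \<sigma> by (auto simp: cochains_iff face_def distinct_card[symmetric])
  moreover have "?f \<noteq> (\<lambda>vs. 0)"
  proof
    assume "?f = (\<lambda>vs. 0)"
    from fun_cong[OF this, of vs] show False
      using vs r vandermonde_nonzero[of "\<lambda>v. real (r v)" vs] by (simp add: inj_on_def)
  qed
  ultimately show ?thesis by (intro bexI[of _ ?f])
qed

lemma continuous_on_tuple_inner_self:
  assumes "\<And>vs. continuous_on UNIV (\<lambda>\<phi>. F \<phi> vs)"
  shows "continuous_on UNIV (\<lambda>\<phi>. tuple_inner m (F \<phi>) (F \<phi>))"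
  unfolding tuple_inner_def by (intro continuous_intros assms)

lemma continuous_on_energy: "continuous_on UNIV (\<lambda>\<phi>. energy m \<phi> \<phi>)"
proof -
  have "continuous_on UNIV (\<lambda>\<phi>. d k \<phi> vs)" for k vs
    by (cases "face vs \<and> length vs = Suc k")
      (auto simp: d_eq alt_sum_def intro!: continuous_intros continuous_on_product_coordinates)
  moreover have "continuous_on UNIV (\<lambda>\<phi>. codiff \<phi> vs)" for vs
    unfolding codiff_def by (intro continuous_intros continuous_on_product_coordinates)
  ultimately show ?thesis
    unfolding energy_def by (intro continuous_intros continuous_on_tuple_inner_self) auto
qed

text \<open>
  A cochain of norm one has values in \<open>[-1, 1]\<close>, so the unit sphere is a closed subset of a product of
  compact intervals.
\<close>

lemma compact_unit_cochains: "compact {\<phi> \<in> C m. tuple_inner m \<phi> \<phi> = 1}"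
proof -
  let ?cube = "Pi\<^sub>E UNIV (\<lambda>_::'a list. {- 1..1::real})"
  have "compactin (product_topology (\<lambda>_. euclidean) UNIV) ?cube"
    unfolding compactin_PiE by simp
  then have "compact ?cube"
    by (simp add: euclidean_product_topology)
  moreover have "closed {\<phi> \<in> C m. tuple_inner m \<phi> \<phi> = 1}"
  proof -
    have "{\<phi> \<in> C m. tuple_inner m \<phi> \<phi> = 1}
        = {\<phi>. (\<forall>xs a b ys. \<phi> (xs @ a # b # ys) = - \<phi> (xs @ b # a # ys))
            \<and> (\<forall>vs\<in>{vs. \<not> (face vs \<and> length vs = m)}. \<phi> vs = 0) \<and> tuple_inner m \<phi> \<phi> = 1}"
      unfolding cochains_iff alternating_def by blast
    moreover have "closed \<dots>"
      unfolding Ball_def mem_Collect_eq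
      by (intro closed_Collect_conj closed_Collect_all closed_Collect_imp open_Collect_const
          closed_Collect_eq continuous_intros continuous_on_product_coordinates
          continuous_on_tuple_inner_self)
    ultimately show ?thesis by simp
  qed
  ultimately have "compact (?cube \<inter> {\<phi> \<in> C m. tuple_inner m \<phi> \<phi> = 1})"
    by (rule compact_Int_closed)
  moreover have "{\<phi> \<in> C m. tuple_inner m \<phi> \<phi> = 1} \<subseteq> ?cube"
  proof
    fix \<phi> assume "\<phi> \<in> {\<phi> \<in> C m. tuple_inner m \<phi> \<phi> = 1}"
    then have \<phi>: "\<phi> \<in> C m" "tuple_inner m \<phi> \<phi> = 1" by auto
    have "\<bar>\<phi> vs\<bar> \<le> 1" for vs
      using cochain_square_le_tuple_inner[OF \<phi>(1), of vs] \<phi>(2) abs_le_square_iff[of "\<phi> vs" 1] by simp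
    then show "\<phi> \<in> ?cube" by (auto simp: abs_le_iff minus_le_iff)
  qed
  ultimately show ?thesis by (simp add: Int_absorb1)
qed

lemma d_combine: "d m (\<lambda>vs. a * \<phi> vs + b * \<psi> vs) = (\<lambda>vs. a * d m \<phi> vs + b * d m \<psi> vs)"
  by (auto simp: fun_eq_iff d_eq alt_sum_def sum_distrib_left sum.distrib algebra_simps)

lemma codiff_combine: "codiff (\<lambda>vs. a * \<phi> vs + b * \<psi> vs) = (\<lambda>vs. a * codiff \<phi> vs + b * codiff \<psi> vs)"
  by (auto simp: fun_eq_iff codiff_def sum_distrib_left sum.distrib algebra_simps)

lemma energy_commute: "energy m \<phi> \<psi> = energy m \<psi> \<phi>"
  by (simp add: energy_def tuple_inner_commute)

lemma energy_combine_right: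
  "energy m \<chi> (\<lambda>vs. a * \<phi> vs + b * \<psi> vs) = a * energy m \<chi> \<phi> + b * energy m \<chi> \<psi>"
  by (simp add: energy_def d_combine codiff_combine tuple_inner_combine_right add_divide_distrib algebra_simps)

lemma energy_combine_left:
  "energy m (\<lambda>vs. a * \<phi> vs + b * \<psi> vs) \<chi> = a * energy m \<phi> \<chi> + b * energy m \<psi> \<chi>"
  by (simp add: energy_def d_combine codiff_combine tuple_inner_combine_left add_divide_distrib algebra_simps)

text \<open>
  The energy attains its minimum on the unit sphere, and both sides of the inequality are homogeneous
  of degree two.
\<close>

lemma exists_energy_minimizer:
  assumes "simplices X (int m - 1) \<noteq> {}"
  shows "\<exists>\<phi>\<in>C m. tuple_inner m \<phi> \<phi> = 1 \<and> (\<forall>\<psi>\<in>C m. energy m \<phi> \<phi> * tuple_inner m \<psi> \<psi> \<le> energy m \<psi> \<psi>)"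
proof -
  let ?K = "{\<phi> \<in> C m. tuple_inner m \<phi> \<phi> = 1}"
  \<comment> \<open>The summand with coefficient \<open>0\<close> gives the multiple of \<open>\<psi>\<close> the form of a linear combination.\<close>
  have normalize: "(\<lambda>vs. c * \<psi> vs + 0 * \<psi> vs) \<in> ?K \<and>
      energy m (\<lambda>vs. c * \<psi> vs + 0 * \<psi> vs) (\<lambda>vs. c * \<psi> vs + 0 * \<psi> vs) = energy m \<psi> \<psi> / tuple_inner m \<psi> \<psi>"
    if "\<psi> \<in> C m" "tuple_inner m \<psi> \<psi> > 0" "c = 1 / sqrt (tuple_inner m \<psi> \<psi>)" for \<psi> c
  proof -
    have "c * c * tuple_inner m \<psi> \<psi> = 1" "c * c = 1 / tuple_inner m \<psi> \<psi>"
      using that by auto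
    then show ?thesis
      using cochain_lincomb[OF that(1) that(1), of c 0]
        energy_combine_left[of m c \<psi> 0 \<psi>] energy_commute[of m \<psi> "\<lambda>vs. c * \<psi> vs + 0 * \<psi> vs"]
        tuple_inner_combine_left[of m c \<psi> 0 \<psi>] tuple_inner_combine_right[of m \<psi> c \<psi> 0 \<psi>]
      by (simp add: mult.assoc[symmetric])
  qed
  obtain \<phi>0 where "\<phi>0 \<in> C m" "\<phi>0 \<noteq> (\<lambda>vs. 0)"
    using exists_nonzero_cochain[OF assms] by blast
  then have "?K \<noteq> {}"
    using normalize[of \<phi>0] tuple_inner_definite[of \<phi>0 m] tuple_inner_nonneg[of m \<phi>0] by fastforce
  then obtain \<phi> where \<phi>: "\<phi> \<in> ?K" and min: "\<And>\<psi>. \<psi> \<in> ?K \<Longrightarrow> energy m \<phi> \<phi> \<le> energy m \<psi> \<psi>"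
    using continuous_attains_inf[OF compact_unit_cochains[of m] _ continuous_on_subset[OF continuous_on_energy]]
    by blast
  have "energy m \<phi> \<phi> * tuple_inner m \<psi> \<psi> \<le> energy m \<psi> \<psi>" if "\<psi> \<in> C m" for \<psi>
  proof (cases "tuple_inner m \<psi> \<psi> = 0")
    case True
    then show ?thesis
      using tuple_inner_nonneg by (simp add: energy_def)
  next
    case False
    then have pos: "tuple_inner m \<psi> \<psi> > 0"
      using tuple_inner_nonneg[of m \<psi>] by simp
    have "energy m \<phi> \<phi> \<le> energy m \<psi> \<psi> / tuple_inner m \<psi> \<psi>"
      using min[OF conjunct1[OF normalize[OF that pos refl]]] conjunct2[OF normalize[OF that pos refl]]
      by linarith
    with pos show ?thesis by (simp add: field_simps)
  qed
  with \<phi> show ?thesis by blast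
qed

text \<open>
  Varying a minimiser \<open>\<phi>\<close> of the energy in a direction \<open>\<eta>\<close> gives \<open>\<langle>\<Delta>\<phi> - \<mu>\<phi>, \<eta>\<rangle> = 0\<close>; with
  \<open>\<eta> = \<Delta>\<phi> - \<mu>\<phi>\<close> this makes \<open>\<phi>\<close> an eigenvector. Any other eigenvalue is the energy of a unit
  eigenvector and hence at least \<open>\<mu>\<close>, so the minimum is indeed \<open>min_eigenvalue\<close>.
\<close>

lemma min_eigenvalue_variational:
  assumes "simplices X (int p) \<noteq> {}"
  shows "\<exists>\<phi>\<in>C (Suc p). tuple_inner (Suc p) \<phi> \<phi> = 1 \<and> energy (Suc p) \<phi> \<phi> = min_eigenvalue X ornt (int p)"
    and "\<psi> \<in> C (Suc p) \<Longrightarrow> min_eigenvalue X ornt (int p) * tuple_inner (Suc p) \<psi> \<psi> \<le> energy (Suc p) \<psi> \<psi>"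
proof -
  let ?m = "Suc p"
  let ?L = "reduced_laplacian X ornt (int p)"
  have ne: "simplices X (int ?m - 1) \<noteq> {}"
    using assms by simp
  from exists_energy_minimizer[OF ne] obtain \<phi> where \<phi>: "\<phi> \<in> C ?m" "tuple_inner ?m \<phi> \<phi> = 1"
    and min: "\<forall>\<psi>\<in>C ?m. energy ?m \<phi> \<phi> * tuple_inner ?m \<psi> \<psi> \<le> energy ?m \<psi> \<psi>"
    by (elim bexE conjE)
  define \<mu> where "\<mu> = energy ?m \<phi> \<phi>"
  have critical: "energy ?m \<phi> \<eta> = \<mu> * tuple_inner ?m \<phi> \<eta>" if \<eta>: "\<eta> \<in> C ?m" for \<eta>
  proof -
    have "0 \<le> 2 * t * (energy ?m \<phi> \<eta> - \<mu> * tuple_inner ?m \<phi> \<eta>) + t\<^sup>2 * (energy ?m \<eta> \<eta> - \<mu> * tuple_inner ?m \<eta> \<eta>)" for t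
    proof -
      let ?\<psi> = "\<lambda>vs. 1 * \<phi> vs + t * \<eta> vs"
      have "energy ?m ?\<psi> ?\<psi> = \<mu> + 2 * t * energy ?m \<phi> \<eta> + t\<^sup>2 * energy ?m \<eta> \<eta>"
        using energy_commute[of ?m \<eta> \<phi>] unfolding energy_combine_left energy_combine_right
        by (simp add: \<mu>_def algebra_simps power2_eq_square)
      moreover have "tuple_inner ?m ?\<psi> ?\<psi> = 1 + 2 * t * tuple_inner ?m \<phi> \<eta> + t\<^sup>2 * tuple_inner ?m \<eta> \<eta>"
        using \<phi>(2) tuple_inner_commute[of ?m \<eta> \<phi>] unfolding tuple_inner_combine_left tuple_inner_combine_right
        by (simp add: algebra_simps power2_eq_square)
      ultimately show ?thesis
        using bspec[OF min cochain_lincomb[OF \<phi>(1) \<eta>, of 1 t]] by (simp add: \<mu>_def algebra_simps)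
    qed
    from linear_term_zero_of_nonneg[OF this] show ?thesis by simp
  qed
  have "laplacian_eigenvalue X ornt (int p) \<mu>"
  proof -
    let ?D = "\<lambda>vs. 1 * ?L \<phi> vs + (- \<mu>) * \<phi> vs"
    have D: "?D \<in> C ?m"
      by (intro cochain_lincomb laplacian_cochain \<phi>)
    have "tuple_inner ?m ?D ?D = 0"
      unfolding tuple_inner_combine_left[of ?m 1 "?L \<phi>" "- \<mu>" \<phi> ?D] tuple_inner_laplacian[OF \<phi>(1) D] critical[OF D] by simp
    from tuple_inner_definite[OF D this] have "?L \<phi> = (\<lambda>vs. \<mu> * \<phi> vs)"
      by (auto simp: fun_eq_iff)
    moreover have "\<phi> \<noteq> (\<lambda>vs. 0)"
      using \<phi>(2) by (auto simp: tuple_inner_def)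
    ultimately show ?thesis
      using \<phi>(1) by (auto simp: laplacian_eigenvalue_def)
  qed
  moreover have "\<mu> \<le> c" if eigenvalue: "laplacian_eigenvalue X ornt (int p) c" for c
  proof -
    obtain \<psi> where \<psi>: "\<psi> \<in> C ?m" "\<psi> \<noteq> (\<lambda>vs. 0)" "?L \<psi> = (\<lambda>vs. c * \<psi> vs)"
      using eigenvalue by (auto simp: laplacian_eigenvalue_def)
    have "energy ?m \<psi> \<psi> = c * tuple_inner ?m \<psi> \<psi>"
      using tuple_inner_laplacian[OF \<psi>(1,1)] unfolding \<psi>(3) by (simp add: tuple_inner_def sum_distrib_left mult.assoc)
    then have "\<mu> * tuple_inner ?m \<psi> \<psi> \<le> c * tuple_inner ?m \<psi> \<psi>"
      using bspec[OF min \<psi>(1)] by (simp add: \<mu>_def)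
    moreover have "tuple_inner ?m \<psi> \<psi> > 0"
      using tuple_inner_definite[OF \<psi>(1)] \<psi>(2) tuple_inner_nonneg[of ?m \<psi>] by force
    ultimately show ?thesis by simp
  qed
  ultimately have "min_eigenvalue X ornt (int p) = \<mu>"
    unfolding min_eigenvalue_def by (rule Least_equality)
  then show "\<exists>\<phi>\<in>C ?m. tuple_inner ?m \<phi> \<phi> = 1 \<and> energy ?m \<phi> \<phi> = min_eigenvalue X ornt (int p)"
    and "\<psi> \<in> C ?m \<Longrightarrow> min_eigenvalue X ornt (int p) * tuple_inner ?m \<psi> \<psi> \<le> energy ?m \<psi> \<psi>"
    using \<phi> bspec[OF min] unfolding \<mu>_def by auto
qed


section \<open>Slices of a cochain\<close>

text \<open>
  Slicing and coning both prepend a vertex; the two orders differ by a swap.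
\<close>

lemma codiff_slice:
  assumes "\<phi> \<in> C m"
  shows "codiff (\<lambda>ws. \<phi> (u # ws)) vs = - codiff \<phi> (u # vs)"
  unfolding codiff_def sum_negf[symmetric]
  by (intro sum.cong refl alternating_Cons_Cons cochain_alternating[OF assms])

lemma sum_tuple_inner_slice:
  "(\<Sum>u\<in>V. tuple_inner m (\<lambda>vs. \<phi> (u # vs)) (\<lambda>vs. \<phi> (u # vs))) = tuple_inner (Suc m) \<phi> \<phi>"
  by (simp add: tuple_inner_def sum_tuples_Suc)

lemma sum_tuple_inner_codiff_slice:
  assumes "\<phi> \<in> C m"
  shows "(\<Sum>u\<in>V. tuple_inner p (codiff (\<lambda>vs. \<phi> (u # vs))) (codiff (\<lambda>vs. \<phi> (u # vs))))
       = tuple_inner (Suc p) (codiff \<phi>) (codiff \<phi>)"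
  by (simp add: tuple_inner_def sum_tuples_Suc codiff_slice[OF assms])

section \<open>Facets of one-vertex extensions\<close>

text \<open>
  For \<open>u \<notin> \<sigma>\<close> this counts the facets of \<open>insert u \<sigma>\<close> through \<open>u\<close> that belong to \<open>X\<close>; for \<open>u \<in> \<sigma>\<close> and
  \<open>\<sigma> \<in> X\<close> it is \<open>1\<close>, the only choice being \<open>v = u\<close>.
\<close>

definition facet_count :: "'a \<Rightarrow> 'a set \<Rightarrow> nat" where
  "facet_count u \<sigma> = card {v \<in> \<sigma>. {u} \<in> link X (\<sigma> - {v})}"

lemma singleton_in_link_iff: "{u} \<in> link X \<sigma> \<longleftrightarrow> u \<notin> \<sigma> \<and> insert u \<sigma> \<in> X"
proof -
  have "{u} \<in> X" if "insert u \<sigma> \<in> X"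
    using that by (rule down_closed) auto
  then show ?thesis by (auto simp: link_def)
qed

lemma face_Cons_iff: "face vs \<Longrightarrow> face (u # vs) \<longleftrightarrow> {u} \<in> link X (set vs)"
  by (auto simp: singleton_in_link_iff face_def)

lemma facet_count_eq:
  assumes "\<sigma> \<in> X" "u \<notin> \<sigma>"
  shows "facet_count u \<sigma> = card {w \<in> insert u \<sigma>. insert u \<sigma> - {w} \<in> X} - 1"
proof -
  have "{v \<in> \<sigma>. {u} \<in> link X (\<sigma> - {v})} = {w \<in> insert u \<sigma>. insert u \<sigma> - {w} \<in> X} - {u}"
    using assms by (auto simp: singleton_in_link_iff insert_Diff_if)
  moreover have "u \<in> {w \<in> insert u \<sigma>. insert u \<sigma> - {w} \<in> X}"
    using assms by auto
  ultimately show ?thesis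
    by (simp add: facet_count_def card_Diff_singleton)
qed

lemma facet_count_le_card: "\<sigma> \<in> X \<Longrightarrow> facet_count u \<sigma> \<le> card \<sigma>"
  unfolding facet_count_def by (rule card_mono) (auto intro: finite_simplex)

text \<open>
  For \<open>u \<noteq> v\<close> both sides are one less than the number of facets in \<open>X\<close> of the same set \<open>\<rho> \<union> {u, v}\<close>.
\<close>

lemma facet_count_swap:
  assumes "\<rho> \<union> {v} \<in> X" "\<rho> \<union> {u} \<in> X" "u \<notin> \<rho>" "v \<notin> \<rho>"
  shows "facet_count u (insert v \<rho>) = facet_count v (insert u \<rho>)"
proof (cases "u = v")
  case False
  then show ?thesis
    using assms facet_count_eq[of "insert v \<rho>" u] facet_count_eq[of "insert u \<rho>" v]
    by (simp add: insert_commute)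
qed simp

section \<open>Coboundaries of the slices\<close>

definition blocked :: "'a \<Rightarrow> 'a list \<Rightarrow> bool" where
  "blocked u vs \<longleftrightarrow> face vs \<and> \<not> face (u # vs)"

lemma card_index_link:
  assumes "distinct vs"
  shows "card {j \<in> {..<length vs}. {u} \<in> link X (set vs - {vs ! j})} = facet_count u (set vs)"
proof -
  have "bij_betw ((!) vs) {j \<in> {..<length vs}. {u} \<in> link X (set vs - {vs ! j})}
      {v \<in> set vs. {u} \<in> link X (set vs - {v})}"
    using assms by (auto simp: bij_betw_def inj_on_def nth_eq_iff_index_eq in_set_conv_nth)
  then show ?thesis
    unfolding facet_count_def by (rule bij_betw_same_card)
qed

lemma set_delete_index:
  assumes "distinct vs" "j < length vs"
  shows "set (take j vs @ drop (Suc j) vs) = set vs - {vs ! j}"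
proof -
  have "vs = take j vs @ vs ! j # drop (Suc j) vs"
    using assms(2) by (rule id_take_nth_drop)
  then have "distinct (take j vs @ vs ! j # drop (Suc j) vs)"
    and "set vs = insert (vs ! j) (set (take j vs @ drop (Suc j) vs))"
    using assms(1) by (metis, metis Un_insert_right list.simps(15) set_append)
  then show ?thesis by auto
qed

text \<open>
  On faces \<open>u # vs\<close> this is the square of \<open>\<phi> vs - d \<phi> (u # vs)\<close>; on blocked pairs it is
  the Cauchy-Schwarz inequality, with only those indices counted that can give a nonzero summand.
\<close>

lemma d_slice_square_le:
  assumes \<phi>: "\<phi> \<in> C (Suc k)" and vs: "length vs = Suc k"
  shows "(d k (\<lambda>ws. \<phi> (u # ws)) vs)\<^sup>2
    \<le> (if face (u # vs) then (\<phi> vs)\<^sup>2 else 0) - 2 * (\<phi> vs * d (Suc k) \<phi> (u # vs)) + (d (Suc k) \<phi> (u # vs))\<^sup>2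
      + (if blocked u vs
         then real (facet_count u (set vs)) * (\<Sum>j<Suc k. (\<phi> (u # take j vs @ drop (Suc j) vs))\<^sup>2) else 0)"
    (is "?lhs \<le> _ + ?rest")
proof -
  consider "face (u # vs)" | "\<not> face vs" | "blocked u vs"
    by (auto simp: blocked_def)
  then show ?thesis
  proof cases
    case 1
    then have "d (Suc k) \<phi> (u # vs) = \<phi> vs - alt_sum (\<lambda>ws. \<phi> (u # ws)) vs"
      and "d k (\<lambda>ws. \<phi> (u # ws)) vs = alt_sum (\<lambda>ws. \<phi> (u # ws)) vs"
      using vs face_ConsD[OF 1] by (simp_all add: d_eq)
    then have "?lhs = (\<phi> vs - d (Suc k) \<phi> (u # vs))\<^sup>2"
      by simp
    also have "\<dots> = (\<phi> vs)\<^sup>2 - 2 * (\<phi> vs * d (Suc k) \<phi> (u # vs)) + (d (Suc k) \<phi> (u # vs))\<^sup>2"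
      by (simp add: power2_eq_square algebra_simps)
    finally show ?thesis
      using 1 by (simp add: blocked_def)
  next
    case 2
    then show ?thesis
      using face_ConsD[of u vs] by (auto simp: d_eq blocked_def)
  next
    case 3
    let ?f = "\<lambda>j. \<phi> (u # take j vs @ drop (Suc j) vs)"
    define J where "J = {j \<in> {..<length vs}. {u} \<in> link X (set vs - {vs ! j})}"
    have dist: "distinct vs" and card_J: "card J = facet_count u (set vs)"
      using 3 card_index_link[of vs u] by (auto simp: blocked_def face_def J_def)
    have zero: "?f j = 0" if "j \<in> {..<length vs} - J" for j
    proof (rule ccontr)
      assume "?f j \<noteq> 0"
      then have "face (u # take j vs @ drop (Suc j) vs)"
        using cochain_support[OF \<phi>] by blast
      then have "u \<notin> set vs - {vs ! j}" "insert u (set vs - {vs ! j}) \<in> X"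
        using set_delete_index[OF dist, of j] that by (auto simp: face_def)
      then show False
        using that by (auto simp: J_def singleton_in_link_iff)
    qed
    have "?lhs = (\<Sum>j<length vs. (- 1) ^ j * ?f j)\<^sup>2"
      using 3 vs by (simp add: d_eq blocked_def alt_sum_def)
    also have "(\<Sum>j<length vs. (- 1) ^ j * ?f j) = (\<Sum>j\<in>J. (- 1) ^ j * ?f j)"
      using zero by (intro sum.mono_neutral_right) (auto simp: J_def)
    also have "\<dots>\<^sup>2 \<le> (\<Sum>j\<in>J. ((- 1) ^ j * ?f j)\<^sup>2) * real (card J)"
      by (rule sum_squared_le_sum_of_squares)
    also have "(\<Sum>j\<in>J. ((- 1) ^ j * ?f j)\<^sup>2) = (\<Sum>j\<in>J. (?f j)\<^sup>2)"
      by (simp add: power_mult_distrib flip: power_mult)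
    also have "\<dots> \<le> (\<Sum>j<length vs. (?f j)\<^sup>2)"
      by (intro sum_mono2) (auto simp: J_def)
    finally have "?lhs \<le> (\<Sum>j<length vs. (?f j)\<^sup>2) * real (facet_count u (set vs))"
      unfolding card_J by (simp add: mult_right_mono)
    then show ?thesis
      using 3 vs by (simp add: blocked_def d_eq mult.commute)
  qed
qed

text \<open>
  Replacing the entry \<open>v\<close> at position \<open>j\<close> by \<open>u\<close> keeps the set of all vertices involved, hence
  blockedness and the facet count. Moving \<open>u\<close> from the front to position \<open>j\<close> only affects the sign.
\<close>

lemma exchange_term_le:
  fixes u :: 'a
  assumes \<phi>: "\<phi> \<in> C m" and j: "j < length vs"
  defines "v \<equiv> vs ! j" and "ws \<equiv> vs[j := u]"
  shows "(if blocked u vs then real (facet_count u (set vs)) * (\<phi> (u # take j vs @ drop (Suc j) vs))\<^sup>2 else 0)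
    \<le> (if blocked v ws \<and> {v} \<in> link X (set ws - {ws ! j}) then real (facet_count v (set ws)) * (\<phi> ws)\<^sup>2 else 0)"
proof (cases "blocked u vs \<and> \<phi> (u # take j vs @ drop (Suc j) vs) \<noteq> 0")
  case True
  define \<rho> where "\<rho> = set (take j vs @ drop (Suc j) vs)"
  have face_vs: "face vs" "\<not> face (u # vs)" and face_rem: "face (u # take j vs @ drop (Suc j) vs)"
    using True cochain_support[OF \<phi>] by (auto simp: blocked_def)
  have ws: "ws = take j vs @ u # drop (Suc j) vs"
    using j by (simp add: ws_def upd_conv_take_nth_drop)
  have dist: "distinct vs" "u \<notin> \<rho>" "insert u \<rho> \<in> X" "distinct (take j vs @ drop (Suc j) vs)"
    using face_vs face_rem by (auto simp: face_def \<rho>_def)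
  have \<rho>: "\<rho> = set vs - {v}"
    using set_delete_index[OF dist(1) j] by (simp add: \<rho>_def v_def)
  have sets: "set vs = insert v \<rho>" "v \<notin> \<rho>"
    using nth_mem[OF j] unfolding \<rho> v_def by auto
  have set_ws: "set ws = insert u \<rho>"
    by (simp add: ws \<rho>_def)
  have "face ws"
    using dist set_ws unfolding face_def by (auto simp: ws \<rho>_def)
  moreover have "\<not> face (v # ws)"
  proof
    assume *: "face (v # ws)"
    then have "u \<noteq> v" "insert v (insert u \<rho>) \<in> X"
      using sets set_ws by (auto simp: face_def)
    then have "face (u # vs)"
      using dist sets face_vs by (auto simp: face_def insert_commute)
    with face_vs show False by simp
  qed
  moreover have "{v} \<in> link X (set ws - {ws ! j})"
    using j sets set_ws dist face_vs by (simp add: singleton_in_link_iff ws_def face_def)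
  moreover have "facet_count u (set vs) = facet_count v (set ws)"
    using facet_count_swap[of \<rho> v u] sets set_ws dist face_vs by (simp add: face_def)
  moreover have "(\<phi> (u # take j vs @ drop (Suc j) vs))\<^sup>2 = (\<phi> ws)\<^sup>2"
    using alternating_move[OF cochain_alternating[OF \<phi>], of "[]" u "take j vs" "drop (Suc j) vs"]
    by (simp add: ws power_mult_distrib flip: power_mult)
  ultimately show ?thesis
    by (simp add: blocked_def)
qed auto

text \<open>
  Reindexing by the exchange replaces \<open>\<phi> (u # \<dots>)\<close> by \<open>\<phi>\<close> at the exchanged tuple. Then only the indices \<open>j\<close>
  with \<open>v\<close> in the link of the \<open>j\<close>-th facet remain, and there are \<open>facet_count\<close> many of them, which accounts
  for the second factor.
\<close>

lemma sum_blocked_le: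
  assumes \<phi>: "\<phi> \<in> C m"
  shows "(\<Sum>u\<in>V. \<Sum>vs\<in>tuples V m. if blocked u vs
      then real (facet_count u (set vs)) * (\<Sum>j<m. (\<phi> (u # take j vs @ drop (Suc j) vs))\<^sup>2) else 0)
    \<le> (\<Sum>u\<in>V. \<Sum>vs\<in>tuples V m. if blocked u vs then (real (facet_count u (set vs)))\<^sup>2 * (\<phi> vs)\<^sup>2 else 0)"
proof -
  let ?I = "V \<times> tuples V m"
  let ?g = "\<lambda>j u vs. if blocked u vs
    then real (facet_count u (set vs)) * (\<phi> (u # take j vs @ drop (Suc j) vs))\<^sup>2 else 0"
  let ?h = "\<lambda>j v ws. if blocked v ws \<and> {v} \<in> link X (set ws - {ws ! j})
    then real (facet_count v (set ws)) * (\<phi> ws)\<^sup>2 else 0"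
  have exchange: "(\<Sum>(u, vs)\<in>?I. ?g j u vs) \<le> (\<Sum>(v, ws)\<in>?I. ?h j v ws)" if "j < m" for j
  proof -
    have "(\<Sum>(u, vs)\<in>?I. ?g j u vs) \<le> (\<Sum>(u, vs)\<in>?I. ?h j (vs ! j) (vs[j := u]))"
      using \<open>j < m\<close> by (intro sum_mono) (auto simp: tuples_def intro!: exchange_term_le[OF \<phi>])
    also have "\<dots> = (\<Sum>(v, ws)\<in>?I. ?h j v ws)"
      using \<open>j < m\<close> nth_mem
      by (intro sum.reindex_bij_witness[of _ "\<lambda>(u, vs). (vs ! j, vs[j := u])" "\<lambda>(u, vs). (vs ! j, vs[j := u])"])
        (auto simp: tuples_def dest!: set_update_subset_insert[THEN subsetD])
    finally show ?thesis .
  qed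
  have "(\<Sum>u\<in>V. \<Sum>vs\<in>tuples V m. if blocked u vs
      then real (facet_count u (set vs)) * (\<Sum>j<m. (\<phi> (u # take j vs @ drop (Suc j) vs))\<^sup>2) else 0)
    = (\<Sum>(u, vs)\<in>?I. \<Sum>j<m. ?g j u vs)"
    unfolding sum.cartesian_product by (intro sum.cong refl) (auto simp: sum_distrib_left)
  also have "\<dots> = (\<Sum>j<m. \<Sum>(u, vs)\<in>?I. ?g j u vs)"
    unfolding case_prod_beta by (rule sum.swap)
  also have "\<dots> \<le> (\<Sum>j<m. \<Sum>(v, ws)\<in>?I. ?h j v ws)"
    by (intro sum_mono exchange) simp
  also have "\<dots> = (\<Sum>(v, ws)\<in>?I. \<Sum>j<m. ?h j v ws)"
    unfolding case_prod_beta by (rule sum.swap)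
  also have "\<dots> = (\<Sum>(v, ws)\<in>?I. if blocked v ws then (real (facet_count v (set ws)))\<^sup>2 * (\<phi> ws)\<^sup>2 else 0)"
  proof (intro sum.cong refl, clarify)
    fix v ws assume "ws \<in> tuples V m"
    then have len: "length ws = m" by (simp add: tuples_def)
    show "(\<Sum>j<m. ?h j v ws) = (if blocked v ws then (real (facet_count v (set ws)))\<^sup>2 * (\<phi> ws)\<^sup>2 else 0)"
    proof (cases "blocked v ws")
      case True
      then have "card {j \<in> {..<m}. {v} \<in> link X (set ws - {ws ! j})} = facet_count v (set ws)"
        using card_index_link[of ws v] len by (simp add: blocked_def face_def)
      with True show ?thesis
        by (simp add: sum.If_cases Int_def power2_eq_square)
    qed simp
  qed
  finally show ?thesis
    unfolding sum.cartesian_product .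
qed

text \<open>
  A vertex weighs at most \<open>1\<close> unless it is blocked with facet count \<open>J \<ge> 2\<close>. In that case
  \<open>J (J - 1) \<le> (k + 1) k\<close>, because \<open>J \<le> k + 1\<close>, and so its weight \<open>J\<^sup>2\<close> is at most \<open>k (k + 1) + J\<close>.
\<close>

lemma sum_weight_le:
  assumes "face vs" "length vs = Suc k"
  shows "(\<Sum>u\<in>V. (if face (u # vs) then 1 else 0) + (if blocked u vs then (real (facet_count u (set vs)))\<^sup>2 else 0))
    \<le> real (card V) + (\<Sum>j = 2..k + 1. real (k * (k + 1) + j) * real (max_link_defect X (int k) j))"
proof -
  let ?J = "\<lambda>u. facet_count u (set vs)"
  let ?w = "\<lambda>j. real (k * (k + 1) + j)"
  have "(if face (u # vs) then 1 else 0) + (if blocked u vs then (real (?J u))\<^sup>2 else 0)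
      \<le> 1 + (\<Sum>j = 2..k + 1. ?w j * of_bool ({u} \<notin> link X (set vs) \<and> ?J u = j))" for u
  proof (cases "face (u # vs)")
    case True
    then show ?thesis by (simp add: blocked_def sum_nonneg)
  next
    case False
    have le: "?J u \<le> k + 1"
      using facet_count_le_card[of "set vs" u] assms by (simp add: face_def distinct_card)
    have link: "{u} \<notin> link X (set vs)"
      using False face_Cons_iff[OF assms(1)] by simp
    show ?thesis
    proof (cases "?J u \<ge> 2")
      case True
      have "(\<Sum>j = 2..k + 1. ?w j * of_bool ({u} \<notin> link X (set vs) \<and> ?J u = j))
          = (\<Sum>j = 2..k + 1. if ?J u = j then ?w j else 0)"
        using link by (intro sum.cong) auto
      also have "\<dots> = ?w (?J u)"
        using True le by simp
      finally have "(\<Sum>j = 2..k + 1. ?w j * of_bool ({u} \<notin> link X (set vs) \<and> ?J u = j)) = ?w (?J u)" .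
      moreover have "?J u * ?J u \<le> k * (k + 1) + ?J u"
      proof -
        have "?J u * (?J u - 1) \<le> (k + 1) * k"
          using le by (intro mult_le_mono) auto
        then show ?thesis
          using True by (simp add: algebra_simps diff_mult_distrib2)
      qed
      then have "(real (?J u))\<^sup>2 \<le> ?w (?J u)"
        unfolding power2_eq_square by (metis of_nat_le_iff of_nat_mult)
      ultimately show ?thesis
        using False by simp
    next
      case small: False
      then have "(real (?J u))\<^sup>2 \<le> 1"
        by (simp add: power_le_one)
      then show ?thesis
        using False sum_nonneg[of "{2..k + 1}" "\<lambda>j. ?w j * of_bool ({u} \<notin> link X (set vs) \<and> ?J u = j)"]
        by simp
    qed
  qed
  then have "(\<Sum>u\<in>V. (if face (u # vs) then 1 else 0) + (if blocked u vs then (real (?J u))\<^sup>2 else 0))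
      \<le> (\<Sum>u\<in>V. 1 + (\<Sum>j = 2..k + 1. ?w j * of_bool ({u} \<notin> link X (set vs) \<and> ?J u = j)))"
    by (intro sum_mono)
  also have "\<dots> = real (card V) + (\<Sum>j = 2..k + 1. ?w j * (\<Sum>u\<in>V. of_bool ({u} \<notin> link X (set vs) \<and> ?J u = j)))"
    unfolding sum.distrib sum_distrib_left by (subst sum.swap) simp
  also have "\<dots> \<le> real (card V) + (\<Sum>j = 2..k + 1. ?w j * real (max_link_defect X (int k) j))"
  proof (intro add_left_mono sum_mono mult_left_mono)
    fix j
    have "set vs \<in> simplices X (int k)"
      using assms by (simp add: simplices_def face_def distinct_card)
    then have "card {u \<in> V. {u} \<notin> link X (set vs) \<and> ?J u = j} \<le> max_link_defect X (int k) j"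
      unfolding max_link_defect_def facet_count_def
      using finite_X by (intro Max_ge) (auto simp: simplices_def)
    moreover have "(\<Sum>u\<in>V. of_bool ({u} \<notin> link X (set vs) \<and> ?J u = j))
        = real (card {u \<in> V. {u} \<notin> link X (set vs) \<and> ?J u = j})"
      using finite_vertices by (simp add: of_bool_def sum.If_cases Int_def)
    ultimately show "(\<Sum>u\<in>V. of_bool ({u} \<notin> link X (set vs) \<and> ?J u = j)) \<le> real (max_link_defect X (int k) j)"
      by simp
  qed simp
  finally show ?thesis .
qed

text \<open>
  Summation of \<open>d_slice_square_le\<close>. The mixed terms are \<open>\<langle>\<phi>, \<delta>\<^sup>*\<delta>\<phi>\<rangle>\<close> and hence a multiple of
  \<open>\<parallel>\<delta>\<phi>\<parallel>\<^sup>2\<close>; in the sums over tuples that multiple is \<open>1 / (k + 2)\<close>.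
\<close>

lemma sum_tuple_inner_d_slice_le:
  assumes \<phi>: "\<phi> \<in> C (Suc k)"
  defines "A \<equiv> tuple_inner (Suc (Suc k)) (d (Suc k) \<phi>) (d (Suc k) \<phi>)"
  shows "(\<Sum>u\<in>V. tuple_inner (Suc k) (d k (\<lambda>vs. \<phi> (u # vs))) (d k (\<lambda>vs. \<phi> (u # vs))))
    \<le> A - 2 * A / real (k + 2)
      + (real (card V) + (\<Sum>j = 2..k + 1. real (k * (k + 1) + j) * real (max_link_defect X (int k) j)))
        * tuple_inner (Suc k) \<phi> \<phi>"
    (is "_ \<le> _ + ?W * _")
proof -
  let ?T = "tuples V (Suc k)"
  let ?a = "\<lambda>u vs. if face (u # vs) then (\<phi> vs)\<^sup>2 else 0"
  let ?x = "\<lambda>u vs. \<phi> vs * d (Suc k) \<phi> (u # vs)"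
  let ?b = "\<lambda>u vs. if blocked u vs
         then real (facet_count u (set vs)) * (\<Sum>j<Suc k. (\<phi> (u # take j vs @ drop (Suc j) vs))\<^sup>2) else 0"
  let ?c = "\<lambda>u vs. if blocked u vs then (real (facet_count u (set vs)))\<^sup>2 * (\<phi> vs)\<^sup>2 else 0"
  have cross: "(\<Sum>u\<in>V. \<Sum>vs\<in>?T. ?x u vs) = A / real (k + 2)"
  proof -
    have "(\<Sum>u\<in>V. \<Sum>vs\<in>?T. ?x u vs) = tuple_inner (Suc k) \<phi> (codiff (d (Suc k) \<phi>))"
      unfolding tuple_inner_def codiff_def sum_distrib_left by (rule sum.swap)
    then show ?thesis
      using tuple_inner_d_left[OF d_cochain[OF \<phi>], of \<phi>] by (simp add: A_def)
  qed
  have square: "(\<Sum>u\<in>V. \<Sum>vs\<in>?T. (d (Suc k) \<phi> (u # vs))\<^sup>2) = A"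
    by (simp add: A_def tuple_inner_self sum_tuples_Suc[of _ V "Suc k"])
  have weight: "(\<Sum>u\<in>V. \<Sum>vs\<in>?T. ?a u vs) + (\<Sum>u\<in>V. \<Sum>vs\<in>?T. ?c u vs) \<le> ?W * tuple_inner (Suc k) \<phi> \<phi>"
  proof -
    have "(\<Sum>u\<in>V. \<Sum>vs\<in>?T. ?a u vs) + (\<Sum>u\<in>V. \<Sum>vs\<in>?T. ?c u vs)
        = (\<Sum>vs\<in>?T. \<Sum>u\<in>V. ?a u vs + ?c u vs)"
      by (simp only: sum.distrib[symmetric] sum.swap[of _ ?T])
    also have "\<dots> = (\<Sum>vs\<in>?T. (\<Sum>u\<in>V. (if face (u # vs) then 1 else 0)
        + (if blocked u vs then (real (facet_count u (set vs)))\<^sup>2 else 0)) * (\<phi> vs)\<^sup>2)"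
      unfolding sum_distrib_right by (intro sum.cong refl) (auto simp: algebra_simps)
    also have "\<dots> \<le> (\<Sum>vs\<in>?T. ?W * (\<phi> vs)\<^sup>2)"
    proof (rule sum_mono)
      fix vs
      show "(\<Sum>u\<in>V. (if face (u # vs) then 1 else 0)
        + (if blocked u vs then (real (facet_count u (set vs)))\<^sup>2 else 0)) * (\<phi> vs)\<^sup>2 \<le> ?W * (\<phi> vs)\<^sup>2"
      proof (cases "\<phi> vs = 0")
        case False
        with cochain_support[OF \<phi>] show ?thesis
          by (intro mult_right_mono sum_weight_le) auto
      qed simp
    qed
    finally show ?thesis
      by (simp add: tuple_inner_self sum_distrib_left)
  qed
  have "(\<Sum>u\<in>V. tuple_inner (Suc k) (d k (\<lambda>vs. \<phi> (u # vs))) (d k (\<lambda>vs. \<phi> (u # vs))))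
      \<le> (\<Sum>u\<in>V. \<Sum>vs\<in>?T. ?a u vs - 2 * ?x u vs + (d (Suc k) \<phi> (u # vs))\<^sup>2 + ?b u vs)"
    unfolding tuple_inner_self by (intro sum_mono d_slice_square_le[OF \<phi>]) (simp add: tuples_def)
  also have "\<dots> = (\<Sum>u\<in>V. \<Sum>vs\<in>?T. ?a u vs) - 2 * (\<Sum>u\<in>V. \<Sum>vs\<in>?T. ?x u vs)
      + (\<Sum>u\<in>V. \<Sum>vs\<in>?T. (d (Suc k) \<phi> (u # vs))\<^sup>2) + (\<Sum>u\<in>V. \<Sum>vs\<in>?T. ?b u vs)"
    by (simp only: sum.distrib sum_subtractf sum_distrib_left)
  finally show ?thesis
    using sum_blocked_le[OF \<phi>] weight unfolding cross square by simp
qed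

end

section \<open>The inequality between consecutive spectral gaps\<close>

theorem theorem1p6:
  fixes X :: "'a set set" and ornt :: "'a set \<Rightarrow> 'a list" and n k :: nat
  assumes "finite_simplicial_complex X"
    and "connected_complex X"
    and "orientation X ornt"
    and "card (vertices X) = n"
    and "k \<ge> 1"
    and "simplices X (int k) \<noteq> {}"
  shows "real k * min_eigenvalue X ornt (int k) \<ge>
           real (k + 1) * min_eigenvalue X ornt (int k - 1) - real n
           - (\<Sum>j = 2..k + 1. real (k * (k + 1) + j) * real (max_link_defect X (int k) j))"
proof -
  interpret oriented_complex X ornt
    using assms(1,3) by unfold_locales
  obtain p where k: "k = Suc p"
    using \<open>k \<ge> 1\<close> by (cases k) auto
  have facet: "simplices X (int p) \<noteq> {}"
  proof -
    obtain \<sigma> where \<sigma>: "\<sigma> \<in> X" "finite \<sigma>" "card \<sigma> = Suc k"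
      using assms(6) by (auto simp: simplices_def)
    then obtain v where "v \<in> \<sigma>" by fastforce
    with \<sigma> have "\<sigma> - {v} \<in> simplices X (int p)"
      using down_closed[of \<sigma> "\<sigma> - {v}"] by (simp add: simplices_def k card_Diff_singleton)
    then show ?thesis by blast
  qed
  define \<mu> where "\<mu> = min_eigenvalue X ornt (int k)"
  define \<mu>' where "\<mu>' = min_eigenvalue X ornt (int p)"
  from min_eigenvalue_variational(1)[OF assms(6)] obtain \<phi> where \<phi>: "\<phi> \<in> C (Suc k)"
    and unit: "tuple_inner (Suc k) \<phi> \<phi> = 1" and energy: "energy (Suc k) \<phi> \<phi> = \<mu>"
    unfolding \<mu>_def by (elim bexE conjE)
  let ?\<phi> = "\<lambda>u vs. \<phi> (u # vs)"
  define A where "A = tuple_inner (Suc (Suc k)) (d (Suc k) \<phi>) (d (Suc k) \<phi>)"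
  define B where "B = tuple_inner k (codiff \<phi>) (codiff \<phi>)"
  define S where "S = (\<Sum>u\<in>V. tuple_inner (Suc k) (d k (?\<phi> u)) (d k (?\<phi> u)))"
  define W where "W = real n + (\<Sum>j = 2..k + 1. real (k * (k + 1) + j) * real (max_link_defect X (int k) j))"
  have "\<mu>' = (\<Sum>u\<in>V. \<mu>' * tuple_inner k (?\<phi> u) (?\<phi> u))"
    unfolding sum_distrib_left[symmetric] sum_tuple_inner_slice unit by simp
  also have "\<dots> \<le> (\<Sum>u\<in>V. energy k (?\<phi> u) (?\<phi> u))"
    using min_eigenvalue_variational(2)[OF facet] cochain_slice[OF \<phi>]
    by (intro sum_mono) (simp add: \<mu>'_def k)
  also have "\<dots> = S / real (k + 1) + real k * B"
    using sum_tuple_inner_codiff_slice[OF \<phi>, of p]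
    by (simp add: energy_def S_def B_def k sum.distrib sum_divide_distrib sum_distrib_left[symmetric])
  finally have "real (k + 1) * \<mu>' \<le> real (k + 1) * (S / real (k + 1) + real k * B)"
    by (intro mult_left_mono) auto
  also have "\<dots> = S + real k * (real (k + 1) * B)"
    by (simp add: field_simps)
  also have "S \<le> A - 2 * A / real (k + 2) + W"
    using sum_tuple_inner_d_slice_le[OF \<phi>] unit assms(4) by (simp add: S_def A_def W_def)
  also have "A - 2 * A / real (k + 2) + W + real k * (real (k + 1) * B)
      = real k * (A / real (k + 2) + real (k + 1) * B) + W"
    by (simp add: field_simps)
  also have "A / real (k + 2) + real (k + 1) * B = \<mu>"
    using energy by (simp add: energy_def A_def B_def)
  finally show ?thesis
    by (simp add: \<mu>_def \<mu>'_def W_def k)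
qed

end
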